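(* Let $\mathcal{P}=\{A_1,A_2,A_4,A_5\}$. Then for every integer $n\ge 1$, $$s_n(\mathcal{P})=L(n+1),$$ where $L(m)$ is the number of lattice paths from $(2,2,\dots,2)\in\mathbb{Z}^m$ to $(0,0,\dots,0)\in\mathbb{Z}^m$ using steps that decrement one component by $1$, such that each point $(p_1,p_2,\dots,p_m)$ of the path satisfies $|p_i-p_{i+1}|\le 1$ for all $1\le i\le m-1$.
   Context: A standard piece is a $2\times 2$ matrix whose four entries are $1,2,3,4$, each occurring exactly once. For $n\ge 1$, a standard $n$-puzzle is a $2\times(n+1)$ matrix whose entries are $1,2,\dots,2n+2$, each occurring exactly once; its pieces are its $n$ submatrices formed by two consecutive columns. The reduction of a piece is the standard piece obtained by replacing its four distinct entries by $1,2,3,4$ in an order-preserving way. A set $\mathcal{P}$ of standard pieces is a support of a puzzle if the reduction of each piece of the puzzle lies in $\mathcal{P}$. $S_n(\mathcal{P})$ is the set of standard $n$-puzzles having $\mathcal{P}$ as a support, and $s_n(\mathcal{P})=|S_n(\mathcal{P})|$. The standard pieces used are $A_1=\left[\begin{smallmatrix}4&3\\1&2\end{smallmatrix}\right]$, $A_2=\left[\begin{smallmatrix}3&4\\1&2\end{smallmatrix}\right]$, $A_4=\left[\begin{smallmatrix}3&4\\2&1\end{smallmatrix}\right]$, $A_5=\left[\begin{smallmatrix}4&3\\2&1\end{smallmatrix}\right]$. *)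

theory Defs
  imports "Jordan_Normal_Form.Matrix"
begin

text \<open>Rows, columns and vector components are numbered from 0.\<close>

abbreviation positions :: "nat mat \<Rightarrow> (nat \<times> nat) set" where
  "positions M \<equiv> {0..<dim_row M} \<times> {0..<dim_col M}"

definition standard_piece :: "nat mat \<Rightarrow> bool" where
  "standard_piece M \<longleftrightarrow> M \<in> carrier_mat 2 2 \<and> bij_betw (($$) M) (positions M) {1..4}"

definition standard_puzzle :: "nat \<Rightarrow> nat mat \<Rightarrow> bool" where
  "standard_puzzle n M \<longleftrightarrow>
     M \<in> carrier_mat 2 (n + 1) \<and> bij_betw (($$) M) (positions M) {1..2 * n + 2}"

definition piece :: "nat mat \<Rightarrow> nat \<Rightarrow> nat mat" where
  "piece M j = mat 2 2 (\<lambda>(i, k). M $$ (i, j + k))"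

text \<open>Every entry is replaced by its rank among the entries. That this is the order-preserving
  replacement by \<open>1, 2, 3, 4\<close> is the content of \<open>reduction_unique\<close> below.\<close>

definition reduction :: "nat mat \<Rightarrow> nat mat" where
  "reduction M = map_mat (\<lambda>x. card {y \<in> elements_mat M. y \<le> x}) M"

definition is_support :: "nat mat set \<Rightarrow> nat mat \<Rightarrow> bool" where
  "is_support P M \<longleftrightarrow> (\<forall>j. j + 1 < dim_col M \<longrightarrow> reduction (piece M j) \<in> P)"

definition puzzles :: "nat \<Rightarrow> nat mat set \<Rightarrow> nat mat set" where
  "puzzles n P = {M. standard_puzzle n M \<and> is_support P M}"

definition num_puzzles :: "nat \<Rightarrow> nat mat set \<Rightarrow> nat" where
  "num_puzzles n P = card (puzzles n P)"

definition A1 :: "nat mat" where "A1 = mat_of_rows_list 2 [[4, 3], [1, 2]]"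
definition A2 :: "nat mat" where "A2 = mat_of_rows_list 2 [[3, 4], [1, 2]]"
definition A4 :: "nat mat" where "A4 = mat_of_rows_list 2 [[3, 4], [2, 1]]"
definition A5 :: "nat mat" where "A5 = mat_of_rows_list 2 [[4, 3], [2, 1]]"

definition lattice_step :: "nat \<Rightarrow> int vec \<Rightarrow> int vec \<Rightarrow> bool" where
  "lattice_step m p q \<longleftrightarrow> (\<exists>i<m. q = p - unit_vec m i)"

text \<open>A lattice path is the list of the points it visits.\<close>

definition lattice_paths :: "nat \<Rightarrow> int vec list set" where
  "lattice_paths m =
     {ps. ps \<noteq> [] \<and> set ps \<subseteq> carrier_vec m
        \<and> hd ps = vec m (\<lambda>_. 2) \<and> last ps = 0\<^sub>v m
        \<and> successively (lattice_step m) ps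
        \<and> (\<forall>p\<in>set ps. \<forall>i. i + 1 < m \<longrightarrow> \<bar>p $ i - p $ (i + 1)\<bar> \<le> 1)}"

definition L :: "nat \<Rightarrow> nat" where
  "L m = card (lattice_paths m)"

lemma card_rank: "card {y \<in> {1..N::nat}. y \<le> x} = x" if "x \<le> N"
proof -
  have "{y \<in> {1..N}. y \<le> x} = {1..x}" using that by auto
  then show ?thesis by simp
qed

lemma elements_mat_image: "elements_mat M = (($$) M) ` positions M"
proof
  show "elements_mat M \<subseteq> (($$) M) ` positions M"
  proof
    fix a assume "a \<in> elements_mat M"
    then obtain i j where "i < dim_row M" "j < dim_col M" "a = M $$ (i, j)" by blast
    then show "a \<in> (($$) M) ` positions M" by (intro image_eqI[of _ _ "(i, j)"]) simp_all
  qed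
  show "(($$) M) ` positions M \<subseteq> elements_mat M"
  proof
    fix a assume "a \<in> (($$) M) ` positions M"
    then obtain i j where ij: "i < dim_row M" "j < dim_col M" "a = M $$ (i, j)"
      by (elim imageE SigmaE) simp
    show "a \<in> elements_mat M" by (rule elements_matI[OF carrier_mat_triv ij])
  qed
qed

lemma rank_less_iff:
  assumes "finite E" "x \<in> E" "y \<in> E"
  shows "card {z \<in> E. z \<le> x} < card {z \<in> E. z \<le> y} \<longleftrightarrow> x < (y::nat)"
proof
  assume "x < y"
  then have "{z \<in> E. z \<le> x} \<subseteq> {z \<in> E. z \<le> y}"
    "y \<in> {z \<in> E. z \<le> y}" "y \<notin> {z \<in> E. z \<le> x}"
    using assms by auto
  then have "{z \<in> E. z \<le> x} \<subset> {z \<in> E. z \<le> y}" by blast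
  then show "card {z \<in> E. z \<le> x} < card {z \<in> E. z \<le> y}"
    using assms(1) by (intro psubset_card_mono) auto
next
  assume *: "card {z \<in> E. z \<le> x} < card {z \<in> E. z \<le> y}"
  show "x < y"
  proof (rule ccontr)
    assume "\<not> x < y"
    then have "{z \<in> E. z \<le> y} \<subseteq> {z \<in> E. z \<le> x}" by auto
    then have "card {z \<in> E. z \<le> y} \<le> card {z \<in> E. z \<le> x}"
      using assms(1) by (intro card_mono) auto
    with * show False by simp
  qed
qed

lemma reduction_unique:
  assumes M: "M \<in> carrier_mat 2 2" and inj: "inj_on (($$) M) (positions M)"
  shows "standard_piece R \<and>
      (\<forall>p\<in>positions M. \<forall>q\<in>positions M. R $$ p < R $$ q \<longleftrightarrow> M $$ p < M $$ q)
    \<longleftrightarrow> R = reduction M"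
proof -
  define Q :: "(nat \<times> nat) set" where "Q = {0..<2} \<times> {0..<2}"
  have pos: "positions N = Q" if "N \<in> carrier_mat 2 2" for N using that by (auto simp: Q_def)
  have finQ: "finite Q" and cardQ: "card Q = 4" by (auto simp: Q_def)
  define E where "E = elements_mat M"
  have E: "E = (($$) M) ` Q" unfolding E_def elements_mat_image pos[OF M] by (rule refl)
  have finE: "finite E" unfolding E using finQ by (rule finite_imageI)
  have injQ: "inj_on (($$) M) Q" using inj unfolding pos[OF M] .
  have cardE: "card E = 4" unfolding E card_image[OF injQ] by (rule cardQ)
  have redC: "reduction M \<in> carrier_mat 2 2" using M by (simp add: reduction_def)
  have red: "reduction M $$ p = card {z \<in> E. z \<le> M $$ p}" if "p \<in> Q" for p
    using that M by (auto simp: reduction_def E_def Q_def)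
  have ord: "reduction M $$ p < reduction M $$ q \<longleftrightarrow> M $$ p < M $$ q" if "p \<in> Q" "q \<in> Q" for p q
    unfolding red[OF that(1)] red[OF that(2)] by (intro rank_less_iff finE) (use that E in auto)
  have inj_red: "inj_on (($$) (reduction M)) Q"
  proof (rule inj_onI)
    fix p q assume pq: "p \<in> Q" "q \<in> Q" "reduction M $$ p = reduction M $$ q"
    have "M $$ p = M $$ q" using ord[OF pq(1,2)] ord[OF pq(2,1)] pq(3) by linarith
    then show "p = q" by (rule inj_onD[OF injQ _ pq(1,2)])
  qed
  have sub: "(($$) (reduction M)) ` Q \<subseteq> {1..4}"
  proof
    fix v assume "v \<in> (($$) (reduction M)) ` Q"
    then obtain p where p: "p \<in> Q" "v = card {z \<in> E. z \<le> M $$ p}" using red by auto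
    have "M $$ p \<in> {z \<in> E. z \<le> M $$ p}" using p E by auto
    then have "v > 0" unfolding p(2) card_gt_0_iff using finE by auto
    moreover have "v \<le> 4" unfolding p(2) cardE[symmetric] by (intro card_mono finE) auto
    ultimately show "v \<in> {1..4}" by auto
  qed
  have "(($$) (reduction M)) ` Q = {1..4}"
    by (rule card_subset_eq[OF _ sub]) (simp_all add: card_image[OF inj_red] cardQ)
  then have std: "standard_piece (reduction M)"
    using inj_red redC unfolding standard_piece_def bij_betw_def pos[OF redC] by blast
  have uniq: "R = reduction M" if R: "standard_piece R"
    and o: "\<forall>p\<in>Q. \<forall>q\<in>Q. R $$ p < R $$ q \<longleftrightarrow> M $$ p < M $$ q"
  proof (rule eq_matI)
    have RC: "R \<in> carrier_mat 2 2" using R by (simp add: standard_piece_def)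
    show "dim_row R = dim_row (reduction M)" "dim_col R = dim_col (reduction M)"
      using RC redC by auto
    have bR: "bij_betw (($$) R) Q {1..4}" using R unfolding standard_piece_def pos[OF RC] by (rule conjunct2)
    fix i j assume "i < dim_row (reduction M)" "j < dim_col (reduction M)"
    then have p: "(i, j) \<in> Q" using redC by (auto simp: Q_def)
    let ?T = "{q \<in> Q. M $$ q \<le> M $$ (i, j)}"
    have "M $$ q \<le> M $$ (i, j) \<longleftrightarrow> R $$ q \<le> R $$ (i, j)" if "q \<in> Q" for q
      using o[rule_format, OF p that] by linarith
    then have T: "?T = {q \<in> Q. R $$ q \<le> R $$ (i, j)}" by (intro Collect_cong conj_cong refl)
    have imR: "(($$) R) ` ?T = {y \<in> {1..4}. y \<le> R $$ (i, j)}"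
      unfolding T bij_betw_imp_surj_on[OF bR, symmetric] by (rule Compr_image_eq[symmetric])
    have le: "R $$ (i, j) \<le> 4" using bij_betwE[OF bR] p by auto
    have "R $$ (i, j) = card ((($$) R) ` ?T)" unfolding imR by (rule card_rank[OF le, symmetric])
    also have "\<dots> = card ?T"
      by (intro card_image inj_on_subset[OF bij_betw_imp_inj_on[OF bR]]) auto
    also have "\<dots> = card ((($$) M) ` ?T)"
      by (intro card_image[symmetric] inj_on_subset[OF injQ]) auto
    also have "(($$) M) ` ?T = {z \<in> E. z \<le> M $$ (i, j)}" by (auto simp: E)
    also have "card \<dots> = reduction M $$ (i, j)" by (rule red[OF p, symmetric])
    finally show "R $$ (i, j) = reduction M $$ (i, j)" .
  qed
  show ?thesis
    unfolding pos[OF M]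
  proof
    assume "standard_piece R \<and> (\<forall>p\<in>Q. \<forall>q\<in>Q. R $$ p < R $$ q \<longleftrightarrow> M $$ p < M $$ q)"
    then show "R = reduction M" by (elim conjE) (rule uniq)
  next
    assume R: "R = reduction M"
    show "standard_piece R \<and> (\<forall>p\<in>Q. \<forall>q\<in>Q. R $$ p < R $$ q \<longleftrightarrow> M $$ p < M $$ q)"
      unfolding R by (intro conjI ballI std ord)
  qed
qed

lemma standard_piece_mat_of_rows_list:
  assumes "{a, b, c, d} = {1, 2, 3, 4}"
  shows "standard_piece (mat_of_rows_list 2 [[a, b], [c, d]])"
proof -
  define M where "M = mat_of_rows_list 2 [[a, b], [c, d]]"
  have C: "M \<in> carrier_mat 2 2" unfolding M_def mat_of_rows_list_def by (rule carrier_matI) simp_all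
  have pos: "positions M = {(0, 0), (0, 1), (1, 0), (1, 1)}" using C by auto
  have entries: "M $$ (0, 0) = a" "M $$ (0, 1) = b" "M $$ (1, 0) = c" "M $$ (1, 1) = d"
    unfolding M_def mat_of_rows_list_def by (subst index_mat; simp)+
  have "(($$) M) ` positions M = {a, b, c, d}"
    unfolding pos image_insert image_empty entries ..
  also have "\<dots> = {1..4}" unfolding assms by auto
  finally have im: "(($$) M) ` positions M = {1..4}" .
  have "card (positions M) = 4" unfolding pos by simp
  then have "inj_on (($$) M) (positions M)"
    by (intro eq_card_imp_inj_on) (use im C in simp_all)
  with im C show ?thesis unfolding standard_piece_def bij_betw_def M_def by blast
qed

lemma standard_pieces:
  "standard_piece A1" "standard_piece A2" "standard_piece A4" "standard_piece A5"
  unfolding A1_def A2_def A4_def A5_def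
  by (rule standard_piece_mat_of_rows_list; auto)+

end

theory Submission
  imports Defs
begin

text \<open>
  The four pieces are exactly the standard pieces in which both top entries exceed both bottom
  entries. Reading a puzzle as a schedule, the entries of column \<open>i\<close> are the times at which the
  \<open>i\<close>-th coordinate of a lattice path is decremented, the bottom one first. The coordinates of
  adjacent columns ever differ by 2 iff one of them is decremented twice before the other is
  decremented at all, that is, iff some top entry lies below a neighbouring bottom entry.
\<close>

section \<open>Supported puzzles as an order condition on neighbouring columns\<close>

lemma mat_of_rows_list_2x2:
  "mat_of_rows_list 2 [[a, b], [c, d]] $$ (0, 0) = a"
  "mat_of_rows_list 2 [[a, b], [c, d]] $$ (0, Suc 0) = b"
  "mat_of_rows_list 2 [[a, b], [c, d]] $$ (Suc 0, 0) = c"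
  "mat_of_rows_list 2 [[a, b], [c, d]] $$ (Suc 0, Suc 0) = d"
  by (simp_all add: mat_of_rows_list_def)

text \<open>By \<open>reduction_unique\<close>, only the relative order of the entries matters. Once
  the bottom row lies below the top row, just the order inside each row is free, and the four
  combinations give the four pieces.\<close>

lemma reduction_mem_iff:
  assumes X: "X \<in> carrier_mat 2 2" and inj: "inj_on (($$) X) (positions X)"
  shows "reduction X \<in> {A1, A2, A4, A5} \<longleftrightarrow>
    (\<forall>i<2. \<forall>j<2. X $$ (1, i) < X $$ (0, j))"
proof -
  have pos: "positions X = {(0, 0), (0, 1), (1, 0), (1, 1)}" using X by auto
  have all2: "(\<forall>i<2. Q i) \<longleftrightarrow> Q 0 \<and> Q (Suc 0)" for Q :: "nat \<Rightarrow> bool"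
    by (auto simp: numeral_2_eq_2 less_Suc_eq)
  have red: "reduction X = R \<longleftrightarrow>
      (\<forall>p\<in>positions X. \<forall>q\<in>positions X. R $$ p < R $$ q \<longleftrightarrow> X $$ p < X $$ q)"
    if "standard_piece R" for R
    using reduction_unique[OF X inj, of R] that by auto
  have ne: "X $$ (0, 0) \<noteq> X $$ (0, 1)" "X $$ (1, 0) \<noteq> X $$ (1, 1)"
    using inj unfolding pos by (auto dest: inj_onD)
  show ?thesis
    unfolding insert_iff empty_iff red[OF standard_pieces(1)] red[OF standard_pieces(2)]
      red[OF standard_pieces(3)] red[OF standard_pieces(4)]
    unfolding pos all2 A1_def A2_def A4_def A5_def
    using ne
    by (cases "X $$ (0, 0) < X $$ (0, 1)"; cases "X $$ (1, 0) < X $$ (1, 1)")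
      (auto simp: mat_of_rows_list_2x2)
qed

lemma mem_puzzles_iff:
  assumes "n \<ge> 1"
  shows "M \<in> puzzles n {A1, A2, A4, A5} \<longleftrightarrow> standard_puzzle n M \<and>
    (\<forall>i\<le>n. \<forall>j\<le>n. i \<le> Suc j \<and> j \<le> Suc i \<longrightarrow> M $$ (1, i) < M $$ (0, j))"
proof (cases "standard_puzzle n M")
  case True
  then have dim: "dim_row M = 2" "dim_col M = n + 1"
    and inj: "inj_on (($$) M) (positions M)"
    by (auto simp: standard_puzzle_def bij_betw_def)
  have "reduction (piece M c) \<in> {A1, A2, A4, A5} \<longleftrightarrow>
      (\<forall>i<2. \<forall>j<2. M $$ (1, c + i) < M $$ (0, c + j))" if c: "c < n" for c
  proof -
    have "inj_on (($$) (piece M c)) (positions (piece M c))"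
    proof (rule inj_onI, clarsimp simp: piece_def)
      fix r k r' k' :: nat
      assume "r < 2" "k < 2" "r' < 2" "k' < 2" "M $$ (r, c + k) = M $$ (r', c + k')"
      then show "r = r' \<and> k = k'"
        using inj_onD[OF inj, of "(r, c + k)" "(r', c + k')"] c dim by auto
    qed
    then have "reduction (piece M c) \<in> {A1, A2, A4, A5} \<longleftrightarrow>
      (\<forall>i<2. \<forall>j<2. piece M c $$ (1, i) < piece M c $$ (0, j))"
      by (intro reduction_mem_iff) (auto simp: piece_def)
    then show ?thesis by (simp add: piece_def)
  qed
  then have "M \<in> puzzles n {A1, A2, A4, A5} \<longleftrightarrow>
      (\<forall>c<n. \<forall>i<2. \<forall>j<2. M $$ (1, c + i) < M $$ (0, c + j))"
    using True dim by (simp add: puzzles_def is_support_def)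
  also have "\<dots> \<longleftrightarrow> (\<forall>i\<le>n. \<forall>j\<le>n. i \<le> Suc j \<and> j \<le> Suc i \<longrightarrow> M $$ (1, i) < M $$ (0, j))"
  proof (intro iffI allI impI)
    fix i j assume *: "\<forall>c<n. \<forall>i<2. \<forall>j<2. M $$ (1, c + i) < M $$ (0, c + j)"
      and ij: "i \<le> n" "j \<le> n" "i \<le> Suc j \<and> j \<le> Suc i"
    \<comment> \<open>A piece covering columns \<open>i\<close> and \<open>j\<close> can start at
      the smaller one, except when \<open>i = j = n\<close>: no piece starts at the last column, so
      the one at \<open>n - 1\<close> is taken, which exists because \<open>n\<close> is
      positive.\<close>
    define c where "c = (if min i j = n then n - 1 else min i j)"
    have "c < n" "i - c < 2" "j - c < 2" "c + (i - c) = i" "c + (j - c) = j"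
      using ij assms by (auto simp: c_def min_def split: if_splits)
    then show "M $$ (1, i) < M $$ (0, j)" using * by metis
  qed auto
  finally show ?thesis using True by simp
qed (simp add: puzzles_def)

section \<open>From puzzles to lattice paths\<close>

definition path_of :: "nat \<Rightarrow> nat mat \<Rightarrow> int vec list" where
  "path_of m M = map (\<lambda>k. vec m (\<lambda>i. 2 - of_bool (M $$ (1, i) \<le> k) - of_bool (M $$ (0, i) \<le> k)))
     [0..<2 * m + 1]"

lemma path_of_mem_lattice_paths:
  assumes bij: "bij_betw (($$) M) (positions M) {1..2 * m}" and M: "M \<in> carrier_mat 2 m"
    and less: "\<And>i j. \<lbrakk>i < m; j < m; i \<le> Suc j; j \<le> Suc i\<rbrakk> \<Longrightarrow> M $$ (1, i) < M $$ (0, j)"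
  shows "path_of m M \<in> lattice_paths m"
proof -
  have range: "1 \<le> M $$ (r, i) \<and> M $$ (r, i) \<le> 2 * m" if "r < 2" "i < m" for r i
    using bij_betw_apply[OF bij, of "(r, i)"] that M by auto
  have len: "length (path_of m M) = 2 * m + 1" by (simp add: path_of_def)
  have nth: "path_of m M ! k =
      vec m (\<lambda>i. 2 - of_bool (M $$ (1, i) \<le> k) - of_bool (M $$ (0, i) \<le> k))"
    if "k \<le> 2 * m" for k
    using that unfolding path_of_def by (subst nth_map) (simp_all del: upt_Suc)
  have ne: "path_of m M \<noteq> []" using len by auto
  have step: "lattice_step m (path_of m M ! k) (path_of m M ! Suc k)" if k: "Suc k \<le> 2 * m" for k
  proof -
    have "Suc k \<in> (($$) M) ` positions M"
      using k unfolding bij_betw_imp_surj_on[OF bij] by simp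
    then obtain r c where rc: "r < 2" "c < m" "M $$ (r, c) = Suc k" using M by fastforce
    \<comment> \<open>Entries are distinct, so from time \<open>k\<close> to \<open>Suc k\<close>
      exactly one indicator in \<open>path_of\<close> switches on, the one at \<open>(r, c)\<close>.
      Hence only coordinate \<open>c\<close> drops.\<close>
    have le_Suc: "M $$ (s, i) \<le> Suc k \<longleftrightarrow> M $$ (s, i) \<le> k \<or> (s, i) = (r, c)"
      if "s < 2" "i < m" for s i
      using inj_onD[OF bij_betw_imp_inj_on[OF bij], of "(s, i)" "(r, c)"] that rc M
      by (auto simp: le_Suc_eq)
    have "path_of m M ! Suc k = path_of m M ! k - unit_vec m c"
      unfolding nth[OF k] nth[OF Suc_leD[OF k]]
      using rc by (intro eq_vecI) (auto simp: le_Suc less_2_cases_iff)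
    then show ?thesis using rc(2) unfolding lattice_step_def by blast
  qed
  have "hd (path_of m M) = vec m (\<lambda>_. 2)"
    unfolding hd_conv_nth[OF ne] using range[of 0] range[of 1]
    by (subst nth) (fastforce intro!: eq_vecI)+
  moreover have "last (path_of m M) = 0\<^sub>v m"
    unfolding last_conv_nth[OF ne] len by (simp add: nth) (auto simp: range intro!: eq_vecI)
  moreover have "successively (lattice_step m) (path_of m M)"
    unfolding successively_conv_nth using step len by simp
  moreover have "\<bar>p $ i - p $ (i + 1)\<bar> \<le> 1"
    if p: "p \<in> set (path_of m M)" and i: "i + 1 < m" for p i
  proof -
    obtain k where "k \<le> 2 * m" "p = path_of m M ! k"
      using p len by (metis in_set_conv_nth less_Suc_eq_le Suc_eq_plus1)
    \<comment> \<open>A difference of 2 would put the top entry of one column at or before time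
      \<open>k\<close> and the bottom entry of the other after it, against
      \<open>less\<close>.\<close>
    then show ?thesis
      using i less[of i i] less[of i "i + 1"] less[of "i + 1" i] less[of "i + 1" "i + 1"]
      by (simp add: nth)
  qed
  moreover have "set (path_of m M) \<subseteq> carrier_vec m" by (auto simp: path_of_def)
  ultimately show ?thesis unfolding lattice_paths_def using ne by simp
qed

lemma inj_on_path_of:
  assumes C: "\<And>M. M \<in> S \<Longrightarrow> M \<in> carrier_mat 2 m"
    and le: "\<And>M r i. \<lbrakk>M \<in> S; r < 2; i < m\<rbrakk> \<Longrightarrow> M $$ (r, i) \<le> 2 * m"
    and less: "\<And>M i. \<lbrakk>M \<in> S; i < m\<rbrakk> \<Longrightarrow> M $$ (1, i) < M $$ (0, i)"
  shows "inj_on (path_of m) S"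
proof (rule inj_onI)
  \<comment> \<open>The bottom entry (\<open>r = 1\<close>) comes first, bringing the coordinate
    from 2 to 1; the top entry (\<open>r = 0\<close>) brings it to 0. So the row index is also the
    level reached.\<close>
  have level: "M $$ (r, i) \<le> k \<longleftrightarrow> path_of m M ! k $ i \<le> int r"
    if "M \<in> S" "r < 2" "i < m" "k \<le> 2 * m" for M r i k
  proof -
    have "path_of m M ! k $ i = 2 - of_bool (M $$ (1, i) \<le> k) - of_bool (M $$ (0, i) \<le> k)"
      using that unfolding path_of_def by (subst nth_map) (simp_all del: upt_Suc)
    then show ?thesis using less[of M i] that by (auto simp: less_2_cases_iff)
  qed
  fix M N assume MN: "M \<in> S" "N \<in> S" "path_of m M = path_of m N"
  \<comment> \<open>Taking each of the two entries as the threshold \<open>k\<close> yields both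
    inequalities.\<close>
  have "M $$ (r, i) = N $$ (r, i)" if "r < 2" "i < m" for r i
    using level[of M r i] level[of N r i] le[of M r i] le[of N r i] MN that
    by (metis order_antisym order_refl)
  then show "M = N" using C[OF MN(1)] C[OF MN(2)] by (intro eq_matI) auto
qed

section \<open>Lattice paths and the puzzles read off from them\<close>

lemma lattice_path_step:
  assumes ps: "ps \<in> lattice_paths m" and k: "Suc k < length ps"
  obtains j where "j < m" "\<And>i. i < m \<Longrightarrow> ps ! Suc k $ i = ps ! k $ i - of_bool (i = j)"
proof -
  have "lattice_step m (ps ! k) (ps ! Suc k)"
    using ps k by (simp add: lattice_paths_def successively_conv_nth)
  then obtain j where j: "j < m" "ps ! Suc k = ps ! k - unit_vec m j"
    unfolding lattice_step_def by blast
  moreover have "ps ! k \<in> carrier_vec m"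
    using ps k by (auto simp: lattice_paths_def)
  ultimately have "ps ! Suc k $ i = ps ! k $ i - of_bool (i = j)" if "i < m" for i
    using that by simp
  then show ?thesis using j(1) that by blast
qed

lemma lattice_path_ends:
  assumes "ps \<in> lattice_paths m" "i < m"
  shows "ps ! 0 $ i = 2" "ps ! (length ps - 1) $ i = 0"
  using assms by (auto simp: lattice_paths_def hd_conv_nth last_conv_nth)

text \<open>The sum of the coordinates starts at \<open>2 * m\<close>, loses 1 at every step and
  ends at 0.\<close>

lemma length_lattice_path:
  assumes ps: "ps \<in> lattice_paths m"
  shows "length ps = 2 * m + 1"
proof -
  have ne: "ps \<noteq> []" using ps by (simp add: lattice_paths_def)
  have "(\<Sum>i<m. ps ! k $ i) = 2 * int m - int k" if "k < length ps" for k
    using that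
  proof (induction k)
    case 0
    then show ?case using lattice_path_ends[OF ps] by simp
  next
    case (Suc k)
    obtain j where "j < m" "\<And>i. i < m \<Longrightarrow> ps ! Suc k $ i = ps ! k $ i - of_bool (i = j)"
      using lattice_path_step[OF ps Suc.prems] by blast
    then show ?case using Suc by (simp add: sum_subtractf of_bool_def)
  qed
  from this[of "length ps - 1"] have "0 = 2 * int m - int (length ps - 1)"
    using ne lattice_path_ends[OF ps] by simp
  moreover have "length ps \<noteq> 0" using ne by simp
  ultimately show ?thesis by linarith
qed

lemma lattice_path_antimono:
  assumes ps: "ps \<in> lattice_paths m" and "k \<le> l" "l \<le> 2 * m" "i < m"
  shows "ps ! l $ i \<le> ps ! k $ i"
  using assms(2,3)
proof (induction l rule: dec_induct)
  case (step l)
  then obtain j where "\<And>i. i < m \<Longrightarrow> ps ! Suc l $ i = ps ! l $ i - of_bool (i = j)"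
    using lattice_path_step[OF ps, of l] length_lattice_path[OF ps] by auto
  then have "ps ! Suc l $ i \<le> ps ! l $ i" using \<open>i < m\<close> by simp
  then show ?case using step by simp
qed simp

text \<open>Row \<open>r\<close> records the time of arrival at level \<open>r\<close>, so row 1
  holds the first decrement and row 0 the second.\<close>

definition puzzle_of :: "nat \<Rightarrow> int vec list \<Rightarrow> nat mat" where
  "puzzle_of m ps = mat 2 m (\<lambda>(r, i). LEAST k. ps ! k $ i \<le> int r)"

text \<open>Coordinates never increase, so once level \<open>r\<close> is reached the coordinate
  stays at or below it. The end point 0 ensures that the \<open>LEAST\<close> is attained.\<close>

lemma puzzle_of_le_iff:
  assumes ps: "ps \<in> lattice_paths m" and "r < 2" "i < m" "k \<le> 2 * m"
  shows "puzzle_of m ps $$ (r, i) \<le> k \<longleftrightarrow> ps ! k $ i \<le> int r"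
proof -
  let ?l = "puzzle_of m ps $$ (r, i)"
  have l: "?l = (LEAST k. ps ! k $ i \<le> int r)" using assms by (simp add: puzzle_of_def)
  have "ps ! (2 * m) $ i \<le> int r"
    using lattice_path_ends(2)[OF ps] length_lattice_path[OF ps] assms by simp
  then have "ps ! ?l $ i \<le> int r" unfolding l by (rule LeastI)
  then show ?thesis
    using lattice_path_antimono[OF ps, of ?l k i] assms unfolding l
    by (auto intro: Least_le order_trans)
qed

lemma puzzle_of_range:
  assumes ps: "ps \<in> lattice_paths m" and "r < 2" "i < m"
  shows "puzzle_of m ps $$ (r, i) \<in> {1..2 * m}"
  using puzzle_of_le_iff[OF assms, of 0] puzzle_of_le_iff[OF assms, of "2 * m"]
    lattice_path_ends[OF ps \<open>i < m\<close>] length_lattice_path[OF ps] assms by auto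

lemma puzzle_of_bij:
  assumes ps: "ps \<in> lattice_paths m"
  shows "bij_betw (($$) (puzzle_of m ps)) (positions (puzzle_of m ps)) {1..2 * m}"
proof -
  let ?M = "puzzle_of m ps"
  have pos: "positions ?M = {0..<2} \<times> {0..<m}" by (simp add: puzzle_of_def)
  have inj: "inj_on (($$) ?M) (positions ?M)"
  proof (rule inj_onI, unfold pos, clarsimp)
    fix r i s j assume rs: "r < 2" "i < m" "s < 2" "j < m" "?M $$ (r, i) = ?M $$ (s, j)"
    define k where "k = ?M $$ (r, i) - 1"
    have k: "?M $$ (r, i) = Suc k" "Suc k \<le> 2 * m"
      using puzzle_of_range[OF ps, of r i] rs unfolding k_def by auto
    obtain c where c: "\<And>i. i < m \<Longrightarrow> ps ! Suc k $ i = ps ! k $ i - of_bool (i = c)"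
      using lattice_path_step[OF ps, of k] length_lattice_path[OF ps] k(2) by auto
    \<comment> \<open>An entry \<open>Suc k\<close> in row \<open>t\<close> means that level
      \<open>t\<close> is first reached in this step. The decremented coordinate gives the column,
      and its value before the step gives the row.\<close>
    have "i' = c \<and> ps ! k $ i' = int t + 1" if "t < 2" "i' < m" "?M $$ (t, i') = Suc k" for t i'
      using puzzle_of_le_iff[OF ps that(1,2), of k] puzzle_of_le_iff[OF ps that(1,2), of "Suc k"]
        c[OF that(2)] k(2) that(3) by (cases "i' = c") auto
    from this[of r i] this[of s j] show "r = s \<and> i = j" using rs k(1) by auto
  qed
  have "(($$) ?M) ` positions ?M \<subseteq> {1..2 * m}"
    unfolding pos using puzzle_of_range[OF ps] by fastforce
  \<comment> \<open>Injectivity makes the \<open>2 * m\<close> positions fill all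
    \<open>2 * m\<close> admissible values.\<close>
  moreover have "card ((($$) ?M) ` positions ?M) = card {1..2 * m}"
    using card_image[OF inj] unfolding pos by simp
  ultimately show ?thesis
    using inj unfolding bij_betw_def by (metis card_subset_eq finite_atLeastAtMost)
qed

text \<open>When coordinate \<open>j\<close> reaches 0, coordinate \<open>i\<close> is at most 1, so
  its first decrement has already happened; distinctness of the entries makes the inequality
  strict.\<close>

lemma puzzle_of_less:
  assumes ps: "ps \<in> lattice_paths m" and ij: "i < m" "j < m" "i \<le> Suc j" "j \<le> Suc i"
  shows "puzzle_of m ps $$ (1, i) < puzzle_of m ps $$ (0, j)"
proof -
  define l where "l = puzzle_of m ps $$ (0, j)"
  have l: "l \<in> {1..2 * m}" unfolding l_def using puzzle_of_range[OF ps] ij by simp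
  have j: "ps ! l $ j \<le> 0" using puzzle_of_le_iff[OF ps, of 0 j l] ij l by (simp add: l_def)
  have "ps ! l \<in> set ps" using l length_lattice_path[OF ps] by simp
  then have adj: "\<bar>ps ! l $ c - ps ! l $ (c + 1)\<bar> \<le> 1" if "c + 1 < m" for c
    using ps that by (simp add: lattice_paths_def)
  consider "i = j" | "i = j + 1" | "j = i + 1" using ij by linarith
  then have "\<bar>ps ! l $ i - ps ! l $ j\<bar> \<le> 1"
    using adj[of i] adj[of j] ij(1,2) by cases (simp_all add: abs_minus_commute)
  then have "puzzle_of m ps $$ (1, i) \<le> l"
    using j puzzle_of_le_iff[OF ps, of 1 i l] ij l by simp
  moreover have "puzzle_of m ps $$ (1, i) \<noteq> l"
    using inj_onD[OF bij_betw_imp_inj_on[OF puzzle_of_bij[OF ps]], of "(1, i)" "(0, j)"] ij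
    by (auto simp: l_def puzzle_of_def)
  ultimately show ?thesis by (simp add: l_def)
qed

text \<open>Monotonicity between the end points confines each coordinate to 0, 1, 2, and such a
  value is 2 minus the number of levels among 1 and 0 already reached. This provides surjectivity of
  \<open>path_of\<close>.\<close>

lemma path_of_puzzle_of:
  assumes ps: "ps \<in> lattice_paths m"
  shows "path_of m (puzzle_of m ps) = ps"
proof (rule nth_equalityI)
  show "length (path_of m (puzzle_of m ps)) = length ps"
    by (simp add: path_of_def length_lattice_path[OF ps])
  fix k assume "k < length (path_of m (puzzle_of m ps))"
  then have k: "k \<le> 2 * m" by (simp add: path_of_def)
  have bounds: "0 \<le> ps ! k $ i" "ps ! k $ i \<le> 2" if "i < m" for i
    using lattice_path_antimono[OF ps _ _ that, of 0 k]
      lattice_path_antimono[OF ps _ _ that, of k "2 * m"]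
      lattice_path_ends[OF ps that] length_lattice_path[OF ps] k by auto
  have "ps ! k \<in> carrier_vec m"
    using ps k length_lattice_path[OF ps] by (auto simp: lattice_paths_def)
  then have "ps ! k =
      vec m (\<lambda>i. 2 - of_bool (puzzle_of m ps $$ (1, i) \<le> k) - of_bool (puzzle_of m ps $$ (0, i) \<le> k))"
    using bounds k by (intro eq_vecI) (force simp: puzzle_of_le_iff[OF ps])+
  then show "path_of m (puzzle_of m ps) ! k = ps ! k"
    using k unfolding path_of_def by (subst nth_map) (simp_all del: upt_Suc)
qed

theorem theorem3p3:
  fixes n :: nat
  assumes "n \<ge> 1"
  shows "num_puzzles n {A1, A2, A4, A5} = L (n + 1)"
proof -
  let ?S = "puzzles n {A1, A2, A4, A5}"
  have mem: "M \<in> ?S \<longleftrightarrow>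
      M \<in> carrier_mat 2 (n + 1) \<and> bij_betw (($$) M) (positions M) {1..2 * (n + 1)} \<and>
      (\<forall>i<n + 1. \<forall>j<n + 1. i \<le> Suc j \<and> j \<le> Suc i \<longrightarrow> M $$ (1, i) < M $$ (0, j))" for M
    unfolding mem_puzzles_iff[OF assms] standard_puzzle_def by (simp add: less_Suc_eq_le)
  have "inj_on (path_of (n + 1)) ?S"
  proof (rule inj_on_path_of)
    fix M r i assume M: "M \<in> ?S" and "r < (2::nat)" "i < n + 1"
    then have "(r, i) \<in> positions M" by (auto simp: mem)
    then have "M $$ (r, i) \<in> {1..2 * (n + 1)}" using M bij_betw_apply unfolding mem by fast
    then show "M $$ (r, i) \<le> 2 * (n + 1)" by simp
  qed (auto simp: mem)
  moreover have "path_of (n + 1) ` ?S = lattice_paths (n + 1)"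
  proof (intro equalityI subsetI)
    fix ps assume "ps \<in> path_of (n + 1) ` ?S"
    then show "ps \<in> lattice_paths (n + 1)"
      unfolding mem image_iff Bex_def by (auto intro!: path_of_mem_lattice_paths)
  next
    fix ps assume ps: "ps \<in> lattice_paths (n + 1)"
    have "puzzle_of (n + 1) ps \<in> ?S"
      unfolding mem using puzzle_of_bij[OF ps] puzzle_of_less[OF ps]
      by (simp add: puzzle_of_def)
    then show "ps \<in> path_of (n + 1) ` ?S" using path_of_puzzle_of[OF ps] by (metis imageI)
  qed
  ultimately show ?thesis
    unfolding num_puzzles_def L_def by (metis card_image)
qed

end
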